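(* Suppose that $(X,T)$ is a transitive dynamical system. Given $A\in C(X,GL(d,\mathbb{R}))$, if there exist $\mu_1\neq\mu_2\in \mathcal{M}^{e}(X,T)$ with $S_{\mu_1}=S_{\mu_2}=X$ and $\int \chi(x)\,d\mu_1<\int \chi(x)\,d\mu_2$, then $A\in\mathcal{R}_d$.
   Context: $(X,d)$ is a compact metric space and $T:X\to X$ is continuous; $(X,T)$ is called a dynamical system. It is transitive if for all nonempty open $U,V\subset X$ there is an integer $n\ge0$ with $U\cap T^{-n}V\ne\emptyset$. $\mathcal{M}^e(X,T)$ is the set of $T$-ergodic Borel probability measures and $S_\mu$ is the support of $\mu$. $C(X,GL(d,\mathbb{R}))$ is the space of continuous maps from $X$ into the invertible $d\times d$ real matrices; $A_n(x)=A(T^{n-1}x)\cdots A(Tx)A(x)$; $\chi(x)=\lim_{n\to\infty}\frac1n\log\|A_n(x)\|$ wherever the limit exists (it exists almost everywhere for every invariant measure, by the subadditive ergodic theorem). $LI_A$ is the set of $x\in X$ for which $\lim_{n\to\infty}\frac1n\log\|A_n(x)\|$ diverges, and $\mathcal{R}_d=\{A\in C(X,GL(d,\mathbb{R}))\mid LI_A\text{ is residual in }X\}$, where residual means containing a dense $G_\delta$ subset. *)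

theory Defs
  imports "HOL-Probability.Probability"
begin

text \<open>The compact metric space is the whole type: compactness of \<open>UNIV\<close> is a
  hypothesis on a type of class \<open>metric_space\<close>.\<close>

definition dynamical_system :: "('a::metric_space \<Rightarrow> 'a) \<Rightarrow> bool" where
  "dynamical_system T \<longleftrightarrow> compact (UNIV :: 'a set) \<and> continuous_on UNIV T"

definition transitive_system :: "('a::metric_space \<Rightarrow> 'a) \<Rightarrow> bool" where
  "transitive_system T \<longleftrightarrow> dynamical_system T \<and>
     (\<forall>U V. open U \<and> open V \<and> U \<noteq> {} \<and> V \<noteq> {} \<longrightarrow> (\<exists>n. U \<inter> (T ^^ n) -` V \<noteq> {}))"

definition invariant_measures :: "('a::metric_space \<Rightarrow> 'a) \<Rightarrow> 'a measure set" where
  "invariant_measures T = {\<mu>. prob_space \<mu> \<and> sets \<mu> = sets borel \<and>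
     (\<forall>B\<in>sets borel. emeasure \<mu> (T -` B) = emeasure \<mu> B)}"

definition ergodic_measures :: "('a::metric_space \<Rightarrow> 'a) \<Rightarrow> 'a measure set" where
  "ergodic_measures T = {\<mu> \<in> invariant_measures T.
     \<forall>B\<in>sets borel. T -` B = B \<longrightarrow> emeasure \<mu> B = 0 \<or> emeasure \<mu> B = 1}"

definition measure_supp :: "'a::metric_space measure \<Rightarrow> 'a set" where
  "measure_supp \<mu> = {x. \<forall>U. open U \<and> x \<in> U \<longrightarrow> emeasure \<mu> U > 0}"

text \<open>The topology of \<open>GL(d,\<real>)\<close> is the subspace topology of the matrix space,
  so continuity is stated there.\<close>

definition C_GL :: "('a::metric_space \<Rightarrow> real^'n^'n) set" where
  "C_GL = {A. continuous_on UNIV A \<and> (\<forall>x. invertible (A x))}"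

primrec cocycle :: "('a \<Rightarrow> 'a) \<Rightarrow> ('a \<Rightarrow> real^'n^'n) \<Rightarrow> nat \<Rightarrow> 'a \<Rightarrow> real^'n^'n" where
  "cocycle T A 0 x = mat 1"
| "cocycle T A (Suc n) x = A ((T ^^ n) x) ** cocycle T A n x"

text \<open>\<open>norm\<close> on \<open>real^'n^'n\<close> is the Frobenius norm; the operator norm is used here.
  All norms on matrices give the same limits.\<close>

definition growth_rate :: "('a \<Rightarrow> 'a) \<Rightarrow> ('a \<Rightarrow> real^'n^'n) \<Rightarrow> 'a \<Rightarrow> nat \<Rightarrow> real" where
  "growth_rate T A x n = ln (onorm ((*v) (cocycle T A n x))) / real n"

text \<open>Where the limit does not exist, \<open>lim\<close> takes one fixed unspecified value
  (\<open>THE\<close> of the empty predicate). This happens only on a Borel set that is null for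
  every invariant measure, so integrals of \<open>lyap_exp\<close> are unaffected.\<close>

definition lyap_exp :: "('a \<Rightarrow> 'a) \<Rightarrow> ('a \<Rightarrow> real^'n^'n) \<Rightarrow> 'a \<Rightarrow> real" where
  "lyap_exp T A x = lim (growth_rate T A x)"

definition LI :: "('a \<Rightarrow> 'a) \<Rightarrow> ('a \<Rightarrow> real^'n^'n) \<Rightarrow> 'a set" where
  "LI T A = {x. \<not> convergent (growth_rate T A x)}"

definition residual :: "'a::metric_space set \<Rightarrow> bool" where
  "residual S \<longleftrightarrow> (\<exists>G. gdelta G \<and> closure G = UNIV \<and> G \<subseteq> S)"

definition R_set :: "('a::metric_space \<Rightarrow> 'a) \<Rightarrow> ('a \<Rightarrow> real^'n^'n) set" where
  "R_set T = {A \<in> C_GL. residual (LI T A)}"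

end

theory Submission
  imports Defs
begin

text \<open>
  The growth rates \<open>f\<^sub>n = growth_rate T A x n\<close> are continuous in \<open>x\<close>, and their lower and upper
  limits, taken in the extended reals, are exactly \<open>T\<close>-invariant
  (\<open>liminf_limsup_growth_rate_invariant\<close>). Ergodicity therefore makes each of them constant almost
  everywhere (\<open>ergodic_invariant_function_AE_const\<close>), say \<open>l\<^sub>i\<close> and \<open>h\<^sub>i\<close> for \<open>\<mu>\<^sub>i\<close>. A property that
  holds almost everywhere for a measure of full support holds on a dense set, so the points with
  lower limit at most \<open>min l\<^sub>1 l\<^sub>2\<close> are dense, and so are the points with upper limit at least
  \<open>max h\<^sub>1 h\<^sub>2\<close>.

  If \<open>min l\<^sub>1 l\<^sub>2 < max h\<^sub>1 h\<^sub>2\<close>, choose reals \<open>p < q\<close> strictly between these two values. By continuity,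
  the set of points where \<open>f\<^sub>n < p\<close> for infinitely many \<open>n\<close> is a dense \<open>G\<^sub>\<delta>\<close>, and so is the set where
  \<open>f\<^sub>n > q\<close> for infinitely many \<open>n\<close>. By Baire's theorem their intersection is still dense, and no
  sequence of growth rates in it converges (\<open>residual_divergence\<close>).

  The gap exists because of the two integrals. Without it, all four constants equal one extended
  real \<open>c\<close>, and the growth rates tend to \<open>c\<close> almost everywhere for both measures. The value of \<open>lim\<close>
  is then determined by \<open>c\<close> alone, also if \<open>c\<close> is infinite: in that case \<open>lim\<close> takes its fixed value
  for divergent real sequences. So \<open>lyap_exp\<close> is almost everywhere the same constant for both
  measures, and the integrals agree.
\<close>

section \<open>The cocycle and its growth rates\<close>

text \<open>The recursion of \<open>cocycle\<close> multiplies on the left, at the end of the orbit. Comparing \<open>x\<close> with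
  \<open>T x\<close> needs the factor at its start.\<close>

lemma cocycle_Suc_base: "cocycle T A (Suc n) x = cocycle T A n (T x) ** A x"
  by (induction n) (simp_all add: funpow_swap1 matrix_mul_assoc)

lemma invertible_cocycle:
  assumes "\<And>x. invertible (A x)"
  shows "invertible (cocycle T A n x)"
  by (induction n) (auto simp: assms invertible_mult invertible_def[of "mat 1"] intro: exI[of _ "mat 1"])

lemma onorm_matrix_pos:
  fixes M :: "real^'n^'n"
  assumes "invertible M"
  shows "onorm ((*v) M) > 0"
proof -
  have "M *v v \<noteq> 0" if "v \<noteq> 0" for v
    using assms that invertible_left_inverse matrix_left_invertible_ker by blast
  moreover obtain v :: "real^'n" where "v \<noteq> 0"
    using nonzero_Basis SOME_Basis by blast
  ultimately show ?thesis
    by (auto simp: onorm_pos_lt matrix_vector_mul_bounded_linear)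
qed

lemma onorm_matrix_mult_le:
  fixes M :: "real^'n^'m" and N :: "real^'k^'n"
  shows "onorm ((*v) (M ** N)) \<le> onorm ((*v) M) * onorm ((*v) N)"
  using onorm_compose[OF matrix_vector_mul_bounded_linear[of M]
      matrix_vector_mul_bounded_linear[of N]]
  by (simp add: o_def matrix_vector_mul_assoc)

text \<open>Multiplication by \<open>M\<close> is undone by its inverse, so the norm changes by a factor that is bounded
  in both directions, uniformly in the other matrix \<open>N\<close>.\<close>

lemma ln_onorm_mult_right_bound:
  fixes M :: "real^'n^'n"
  assumes "invertible M"
  shows "\<exists>K. \<forall>N :: real^'n^'n. invertible N \<longrightarrow>
    \<bar>ln (onorm ((*v) (N ** M))) - ln (onorm ((*v) N))\<bar> \<le> K"
proof -
  from assms obtain M' where M': "M ** M' = mat 1" "M' ** M = mat 1"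
    by (auto simp: invertible_def)
  then have inv': "invertible M'"
    by (auto simp: invertible_def)
  define K where "K = max (ln (onorm ((*v) M))) (ln (onorm ((*v) M')))"
  have "\<bar>ln (onorm ((*v) (N ** M))) - ln (onorm ((*v) N))\<bar> \<le> K"
    if N: "invertible N" for N :: "real^'n^'n"
  proof -
    have pos: "onorm ((*v) N) > 0" "onorm ((*v) (N ** M)) > 0" "onorm ((*v) M) > 0" "onorm ((*v) M') > 0"
      using N assms inv' by (auto intro: onorm_matrix_pos invertible_mult)
    have "ln (onorm ((*v) (N ** M))) \<le> ln (onorm ((*v) N) * onorm ((*v) M))"
      using onorm_matrix_mult_le[of N M] pos by (simp add: ln_mono)
    moreover have "(N ** M) ** M' = N"
      by (simp add: M' flip: matrix_mul_assoc)
    then have "ln (onorm ((*v) N)) \<le> ln (onorm ((*v) (N ** M)) * onorm ((*v) M'))"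
      using onorm_matrix_mult_le[of "N ** M" M'] pos by (simp add: ln_mono)
    ultimately show ?thesis
      using pos by (auto simp: K_def ln_mult)
  qed
  then show ?thesis by blast
qed

text \<open>The operator norm is the norm of the space of bounded linear maps, and the matrix space, having
  finite dimension, embeds into it continuously.\<close>

lemma continuous_on_onorm_matrix: "continuous_on UNIV (\<lambda>M :: real^'n^'m. onorm ((*v) M))"
proof -
  have "linear (\<lambda>M :: real^'n^'m. Blinfun ((*v) M))"
    by (intro linearI blinfun_eqI)
      (simp_all add: bounded_linear_Blinfun_apply matrix_vector_mul_bounded_linear blinfun.add_left
        blinfun.scaleR_left matrix_vector_mult_add_rdistrib scaleR_matrix_vector_assoc)
  then have "continuous_on UNIV (\<lambda>M :: real^'n^'m. norm (Blinfun ((*v) M)))"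
    by (intro continuous_on_norm linear_continuous_on) (simp add: linear_conv_bounded_linear)
  then show ?thesis
    by (simp add: norm_blinfun.rep_eq bounded_linear_Blinfun_apply matrix_vector_mul_bounded_linear)
qed

lemma continuous_on_matrix_matrix_mult:
  fixes f :: "'a::topological_space \<Rightarrow> real^'n^'m" and g :: "'a \<Rightarrow> real^'k^'n"
  assumes "continuous_on S f" "continuous_on S g"
  shows "continuous_on S (\<lambda>x. f x ** g x)"
  unfolding matrix_matrix_mult_def
  by (intro continuous_on_vec_lambda continuous_intros assms)

lemma continuous_on_cocycle:
  assumes T: "continuous_on UNIV T" and A: "continuous_on UNIV A"
  shows "continuous_on UNIV (cocycle T A n)"
proof (induction n)
  case (Suc n)
  have "continuous_on UNIV (T ^^ n)"
    by (induction n) (auto intro: continuous_on_compose continuous_on_compose2[OF T] simp: id_def)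
  then have "continuous_on UNIV (\<lambda>x. A ((T ^^ n) x))"
    by (rule continuous_on_compose2[OF A]) simp
  with Suc show ?case
    by (simp add: continuous_on_matrix_matrix_mult)
qed simp

lemma continuous_on_growth_rate:
  assumes T: "continuous_on UNIV T" and A: "A \<in> C_GL"
  shows "continuous_on UNIV (\<lambda>x. growth_rate T A x n)"
proof -
  have inv: "onorm ((*v) (cocycle T A n x)) > 0" for x
    using A by (intro onorm_matrix_pos invertible_cocycle) (auto simp: C_GL_def)
  have "continuous_on UNIV (\<lambda>x. onorm ((*v) (cocycle T A n x)))"
    by (rule continuous_on_compose2[OF continuous_on_onorm_matrix continuous_on_cocycle])
      (use T A in \<open>auto simp: C_GL_def\<close>)
  then have "continuous_on UNIV (\<lambda>x. ln (onorm ((*v) (cocycle T A n x))))"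
    by (intro continuous_on_ln ballI less_imp_neq[OF inv, symmetric])
  then show ?thesis
    unfolding growth_rate_def divide_inverse by (rule continuous_on_mult_right)
qed

text \<open>The products \<open>A\<^sub>n(T x)\<close> and \<open>A\<^bsub>n+1\<^esub>(x)\<close> differ only by the factor \<open>A x\<close>, whose effect on the
  logarithm is bounded and vanishes after division by \<open>n\<close>. The multiplier \<open>c\<close> corrects for dividing
  by \<open>n\<close> on one side and by \<open>n + 1\<close> on the other. A multiplier tending to \<open>1\<close> and an added
  null sequence leave lower and upper limits in the extended reals unchanged, even infinite ones.\<close>

lemma growth_rate_shift:
  fixes A :: "'a::metric_space \<Rightarrow> real^'n^'n"
  assumes A: "A \<in> C_GL"
  obtains c e :: "nat \<Rightarrow> real"
  where "e \<longlonglongrightarrow> 0" "c \<longlonglongrightarrow> 1"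
    "\<And>n. growth_rate T A (T x) n = e n + c n * growth_rate T A x (n + 1)"
proof -
  let ?h = "\<lambda>x n. ln (onorm ((*v) (cocycle T A n x)))"
  define e where "e n = (?h (T x) n - ?h x (n + 1)) / real n" for n
  define c where "c n = real (Suc n) / real n" for n
  have inv: "invertible (A y)" "invertible (cocycle T A n y)" for y n
    using A by (auto simp: C_GL_def intro: invertible_cocycle)
  obtain K where K: "\<And>N :: real^'n^'n. invertible N \<Longrightarrow>
      \<bar>ln (onorm ((*v) (N ** A x))) - ln (onorm ((*v) N))\<bar> \<le> K"
    using ln_onorm_mult_right_bound[OF inv(1)[of x]] by blast
  have "\<bar>?h (T x) n - ?h x (n + 1)\<bar> \<le> K" for n
    using K[OF inv(2)[of n "T x"]] by (simp only: Suc_eq_plus1[symmetric] cocycle_Suc_base abs_minus_commute)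
  then have "norm (e n) \<le> K / real n" for n
    by (simp add: e_def divide_right_mono)
  then have "e \<longlonglongrightarrow> 0"
    by (intro tendsto_norm_zero_cancel[OF tendsto_sandwich[OF _ _ tendsto_const lim_const_over_n[of K]]]) auto
  moreover have "c \<longlonglongrightarrow> 1"
    unfolding c_def by (rule LIMSEQ_Suc_n_over_n)
  moreover have "growth_rate T A (T x) n = e n + c n * growth_rate T A x (n + 1)" for n
  proof -
    have "c n * growth_rate T A x (n + 1) = ?h x (n + 1) / real n"
      unfolding c_def growth_rate_def Suc_eq_plus1 by (simp del: cocycle.simps of_nat_Suc)
    then show ?thesis
      unfolding e_def diff_divide_distrib by (simp add: growth_rate_def)
  qed
  ultimately show thesis by (rule that)
qed

lemma liminf_limsup_growth_rate_invariant:
  assumes "A \<in> C_GL"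
  shows "limsup (\<lambda>n. ereal (growth_rate T A (T x) n)) = limsup (\<lambda>n. ereal (growth_rate T A x n))"
    and "liminf (\<lambda>n. ereal (growth_rate T A (T x) n)) = liminf (\<lambda>n. ereal (growth_rate T A x n))"
proof -
  obtain c e where c: "c \<longlonglongrightarrow> 1" and e: "e \<longlonglongrightarrow> 0"
    and eq: "\<And>n. growth_rate T A (T x) n = e n + c n * growth_rate T A x (n + 1)"
    using growth_rate_shift[OF assms, where T = T and x = x] by blast
  have c': "(\<lambda>n. ereal (c n)) \<longlonglongrightarrow> 1" and e': "(\<lambda>n. ereal (e n)) \<longlonglongrightarrow> 0"
    using c e by (simp_all add: one_ereal_def zero_ereal_def)
  have eq': "ereal (growth_rate T A (T x) n) = ereal (e n) + ereal (c n) * ereal (growth_rate T A x (n + 1))" for n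
    by (simp add: eq)
  show "limsup (\<lambda>n. ereal (growth_rate T A (T x) n)) = limsup (\<lambda>n. ereal (growth_rate T A x n))"
    unfolding eq' limsup_shift[of "\<lambda>n. ereal (growth_rate T A x n)", symmetric]
    by (subst ereal_limsup_lim_add[OF e'], simp, subst ereal_limsup_lim_mult[OF c']) auto
  show "liminf (\<lambda>n. ereal (growth_rate T A (T x) n)) = liminf (\<lambda>n. ereal (growth_rate T A x n))"
    unfolding eq' liminf_shift[of "\<lambda>n. ereal (growth_rate T A x n)", symmetric]
    by (subst ereal_liminf_lim_add[OF e'], simp, subst ereal_liminf_lim_mult[OF c']) auto
qed

section \<open>Ergodic measures\<close>

text \<open>The constant is the essential supremum. Each superlevel set \<open>{q < g}\<close> is an invariant set, and
  for \<open>q\<close> below the essential supremum it has positive measure, hence full measure.\<close>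

lemma ergodic_invariant_function_AE_const:
  fixes g :: "'a::metric_space \<Rightarrow> ereal"
  assumes \<mu>: "\<mu> \<in> ergodic_measures T"
    and g: "g \<in> borel_measurable borel" and inv: "\<And>x. g (T x) = g x"
  obtains c where "AE x in \<mu>. g x = c"
proof -
  have sets: "sets \<mu> = sets borel" and prob: "prob_space \<mu>"
    using \<mu> by (auto simp: ergodic_measures_def invariant_measures_def)
  have space: "space \<mu> = UNIV"
    using sets_eq_imp_space_eq[OF sets] by simp
  have gm[measurable]: "g \<in> borel_measurable \<mu>"
    using g sets by (simp cong: measurable_cong_sets)
  have above: "AE x in \<mu>. q < g x" if "q < esssup \<mu> g" for q
  proof -
    have B: "{x. q < g x} \<in> sets borel"
      using g by measurable
    have "T -` {x. q < g x} = {x. q < g x}"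
      by (simp add: inv vimage_def)
    with B \<mu> have "emeasure \<mu> {x. q < g x} = 0 \<or> emeasure \<mu> {x. q < g x} = 1"
      by (auto simp: ergodic_measures_def)
    moreover have "emeasure \<mu> {x. q < g x} > 0"
      using esssup_pos_measure[OF gm that] by (simp add: space)
    ultimately have "emeasure \<mu> {x. q < g x} = 1" by auto
    then show ?thesis
      using prob_space.AE_in_set_eq_1[OF prob, of "{x. q < g x}"] B sets
      by (simp add: measure_def)
  qed
  have "AE x in \<mu>. esssup \<mu> g \<le> g x"
  proof -
    \<comment> \<open>Rational thresholds suffice, so the null sets from \<open>above\<close> have a null union.\<close>
    have "AE x in \<mu>. \<forall>r::rat. ereal (of_rat r) < esssup \<mu> g \<longrightarrow> ereal (of_rat r) < g x"
      unfolding AE_all_countable using above by (auto intro: AE_I2)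
    then show ?thesis
    proof eventually_elim
      case (elim x)
      show "esssup \<mu> g \<le> g x"
      proof (rule ccontr)
        assume "\<not> esssup \<mu> g \<le> g x"
        then obtain r where "g x < ereal (of_rat r)" "ereal (of_rat r) < esssup \<mu> g"
          using ereal_dense3[of "g x" "esssup \<mu> g"] unfolding not_le by blast
        with elim show False by (meson less_asym)
      qed
    qed
  qed
  then have "AE x in \<mu>. g x = esssup \<mu> g"
    using esssup_AE[of g \<mu>] by eventually_elim (auto intro: antisym)
  then show thesis by (rule that)
qed

lemma closure_AE_full_support:
  fixes \<mu> :: "'a::metric_space measure"
  assumes sets: "sets \<mu> = sets borel" and supp: "measure_supp \<mu> = UNIV"
    and ae: "AE x in \<mu>. P x"
  shows "closure {x. P x} = UNIV"
proof (rule ccontr)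
  assume "closure {x. P x} \<noteq> UNIV"
  then obtain x where x: "x \<in> - closure {x. P x}" by auto
  have "\<forall>U. open U \<and> x \<in> U \<longrightarrow> emeasure \<mu> U > 0"
    using supp by (auto simp: measure_supp_def)
  from this[rule_format, of "- closure {x. P x}"] x
  have "emeasure \<mu> (- closure {x. P x}) > 0"
    by (simp add: open_Compl)
  moreover have "AE x in \<mu>. x \<notin> - closure {x. P x}"
    using ae by eventually_elim (use closure_subset[of "{x. P x}"] in auto)
  then have "emeasure \<mu> (- closure {x. P x}) = 0"
    by (rule AE_iff_measurable[THEN iffD1, rotated 2])
      (auto simp: sets sets_eq_imp_space_eq[OF sets])
  ultimately show False by simp
qed

section \<open>Residual divergence\<close>

text \<open>Two dense sets, possibly disjoint, on which the sequence comes infinitely often below \<open>p\<close>,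
  respectively above \<open>q > p\<close>, force both behaviours at once on a residual set.\<close>

lemma residual_divergence:
  fixes f :: "nat \<Rightarrow> 'a::metric_space \<Rightarrow> real" and a b :: ereal
  assumes comp: "compact (UNIV :: 'a set)"
    and cont: "\<And>n. continuous_on UNIV (f n)"
    and "a < b"
    and low: "closure {x. liminf (\<lambda>n. ereal (f n x)) \<le> a} = UNIV"
    and high: "closure {x. limsup (\<lambda>n. ereal (f n x)) \<ge> b} = UNIV"
  shows "residual {x. \<not> convergent (\<lambda>n. f n x)}"
proof -
  obtain p where p: "a < ereal p" "ereal p < b"
    using \<open>a < b\<close> ereal_dense2 by blast
  then obtain q where q: "ereal p < ereal q" "ereal q < b"
    using ereal_dense2 by blast
  define P where "P N = (\<Union>n\<in>{N..}. {x. f n x < p})" for N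
  define Q where "Q N = (\<Union>n\<in>{N..}. {x. q < f n x})" for N
  have opn: "open (P N)" "open (Q N)" for N
    unfolding P_def Q_def
    by (intro open_UN ballI open_Collect_less cont continuous_on_const)+
  have "{x. liminf (\<lambda>n. ereal (f n x)) \<le> a} \<subseteq> P N" for N
  proof
    fix x assume "x \<in> {x. liminf (\<lambda>n. ereal (f n x)) \<le> a}"
    with p have "\<not> ereal p \<le> liminf (\<lambda>n. ereal (f n x))" by auto
    then have "\<not> (\<forall>\<^sub>F n in sequentially. ereal p \<le> ereal (f n x))"
      using Liminf_bounded[of "ereal p" "\<lambda>n. ereal (f n x)" sequentially] by blast
    then show "x \<in> P N"
      by (force simp: eventually_sequentially P_def not_le)
  qed
  then have P_dense: "closure (P N) = UNIV" for N
    using low closure_mono top.extremum_uniqueI by metis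
  have "{x. limsup (\<lambda>n. ereal (f n x)) \<ge> b} \<subseteq> Q N" for N
  proof
    fix x assume "x \<in> {x. limsup (\<lambda>n. ereal (f n x)) \<ge> b}"
    with q have "\<not> limsup (\<lambda>n. ereal (f n x)) \<le> ereal q" by auto
    then have "\<not> (\<forall>\<^sub>F n in sequentially. ereal (f n x) \<le> ereal q)"
      using Limsup_bounded[of "\<lambda>n. ereal (f n x)" "ereal q" sequentially] by blast
    then show "x \<in> Q N"
      by (force simp: eventually_sequentially Q_def not_le)
  qed
  then have Q_dense: "closure (Q N) = UNIV" for N
    using high closure_mono top.extremum_uniqueI by metis
  \<comment> \<open>Belonging to all \<open>P N\<close> means \<open>f n x < p\<close> for infinitely many \<open>n\<close>, likewise for \<open>Q\<close> and \<open>q\<close>.\<close>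
  define G where "G = (\<Inter>N. P N \<inter> Q N)"
  have "compact_space (euclidean :: 'a topology)"
    using comp by (simp add: compact_space_def)
  then have "euclidean closure_of \<Inter> (range P \<union> range Q) = topspace euclidean"
    by (intro Baire_category)
      (auto simp: opn P_dense Q_dense compact_imp_locally_compact_space regular_space_euclidean)
  then have "closure G = UNIV"
    by (simp add: G_def Inter_Un_distrib INT_Int_distrib)
  moreover have "gdelta G"
    unfolding G_def by (intro gdelta.intros open_Int opn)
  moreover have "G \<subseteq> {x. \<not> convergent (\<lambda>n. f n x)}"
  proof (intro subsetI CollectI notI)
    fix x assume x: "x \<in> G" and "convergent (\<lambda>n. f n x)"
    then obtain l where l: "(\<lambda>n. f n x) \<longlonglongrightarrow> l" by (auto simp: convergent_def)
    have "l \<le> p"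
    proof (rule ccontr)
      assume "\<not> l \<le> p"
      then obtain N where "\<forall>n\<ge>N. f n x > p"
        using order_tendstoD(1)[OF l] by (auto simp: eventually_sequentially not_le)
      with x show False by (force simp: G_def P_def)
    qed
    moreover have "l \<ge> q"
    proof (rule ccontr)
      assume "\<not> l \<ge> q"
      then obtain N where "\<forall>n\<ge>N. f n x < q"
        using order_tendstoD(2)[OF l] by (auto simp: eventually_sequentially not_le)
      with x show False by (force simp: G_def Q_def)
    qed
    ultimately show False using q by simp
  qed
  ultimately show ?thesis
    by (auto simp: residual_def)
qed

text \<open>For an infinite \<open>c\<close> both sides are definite descriptions of the empty predicate. So \<open>lim\<close> takes the
  same value on any two real sequences that have the same limit in the extended reals.\<close>

lemma lim_eq_ereal_limit:
  fixes f :: "nat \<Rightarrow> real"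
  assumes "liminf (\<lambda>n. ereal (f n)) = c" "limsup (\<lambda>n. ereal (f n)) = c"
  shows "lim f = (THE l. ereal l = c)"
proof -
  have c: "(\<lambda>n. ereal (f n)) \<longlonglongrightarrow> c"
    using assms by (simp add: tendsto_iff_Liminf_eq_Limsup)
  have "f \<longlonglongrightarrow> l \<longleftrightarrow> ereal l = c" for l
    using c by (metis LIMSEQ_unique lim_ereal)
  then show ?thesis by (simp add: lim_def)
qed

section \<open>Two ergodic measures with different exponents\<close>

theorem corollary1p1:
  fixes T :: "'a::metric_space \<Rightarrow> 'a"
    and A :: "'a \<Rightarrow> real^'n^'n"
    and \<mu>\<^sub>1 \<mu>\<^sub>2 :: "'a measure"
  assumes "transitive_system T"
    and "A \<in> C_GL"
    and "\<mu>\<^sub>1 \<in> ergodic_measures T"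
    and "\<mu>\<^sub>2 \<in> ergodic_measures T"
    and "\<mu>\<^sub>1 \<noteq> \<mu>\<^sub>2"
    and "measure_supp \<mu>\<^sub>1 = UNIV"
    and "measure_supp \<mu>\<^sub>2 = UNIV"
    and "(\<integral>x. lyap_exp T A x \<partial>\<mu>\<^sub>1) < (\<integral>x. lyap_exp T A x \<partial>\<mu>\<^sub>2)"
  shows "A \<in> R_set T"
proof -
  have comp: "compact (UNIV :: 'a set)" and contT: "continuous_on UNIV T"
    using assms(1) by (auto simp: transitive_system_def dynamical_system_def)
  have cont: "continuous_on UNIV (\<lambda>x. growth_rate T A x n)" for n
    by (rule continuous_on_growth_rate[OF contT assms(2)])
  have meas[measurable]: "(\<lambda>x. growth_rate T A x n) \<in> borel_measurable borel" for n
    by (rule borel_measurable_continuous_onI[OF cont])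
  define lo where "lo x = liminf (\<lambda>n. ereal (growth_rate T A x n))" for x
  define hi where "hi x = limsup (\<lambda>n. ereal (growth_rate T A x n))" for x
  have m: "lo \<in> borel_measurable borel" "hi \<in> borel_measurable borel"
    unfolding lo_def hi_def by measurable
  have inv: "lo (T x) = lo x" "hi (T x) = hi x" for x
    by (simp_all add: lo_def hi_def liminf_limsup_growth_rate_invariant[OF assms(2)])
  obtain l1 where l1: "AE x in \<mu>\<^sub>1. lo x = l1"
    by (rule ergodic_invariant_function_AE_const[OF assms(3) m(1) inv(1)])
  obtain h1 where h1: "AE x in \<mu>\<^sub>1. hi x = h1"
    by (rule ergodic_invariant_function_AE_const[OF assms(3) m(2) inv(2)])
  obtain l2 where l2: "AE x in \<mu>\<^sub>2. lo x = l2"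
    by (rule ergodic_invariant_function_AE_const[OF assms(4) m(1) inv(1)])
  obtain h2 where h2: "AE x in \<mu>\<^sub>2. hi x = h2"
    by (rule ergodic_invariant_function_AE_const[OF assms(4) m(2) inv(2)])
  have sets: "sets \<mu>\<^sub>1 = sets borel" "sets \<mu>\<^sub>2 = sets borel"
    and prob: "prob_space \<mu>\<^sub>1" "prob_space \<mu>\<^sub>2"
    using assms(3,4) by (auto simp: ergodic_measures_def invariant_measures_def)
  have lo_dense: "closure {x. lo x \<le> min l1 l2} = UNIV"
  proof -
    have "closure {x. lo x = l1} = UNIV" "closure {x. lo x = l2} = UNIV"
      using closure_AE_full_support[OF sets(1) assms(6) l1]
        closure_AE_full_support[OF sets(2) assms(7) l2] by auto
    moreover have "{x. lo x = min l1 l2} \<subseteq> {x. lo x \<le> min l1 l2}" by auto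
    ultimately show ?thesis
      using closure_mono[of "{x. lo x = min l1 l2}"] by (auto simp: min_def split: if_splits)
  qed
  have hi_dense: "closure {x. hi x \<ge> max h1 h2} = UNIV"
  proof -
    have "closure {x. hi x = h1} = UNIV" "closure {x. hi x = h2} = UNIV"
      using closure_AE_full_support[OF sets(1) assms(6) h1]
        closure_AE_full_support[OF sets(2) assms(7) h2] by auto
    moreover have "{x. hi x = max h1 h2} \<subseteq> {x. hi x \<ge> max h1 h2}" by auto
    ultimately show ?thesis
      using closure_mono[of "{x. hi x = max h1 h2}"] by (auto simp: max_def split: if_splits)
  qed
  have "min l1 l2 < max h1 h2"
  proof (rule ccontr)
    assume *: "\<not> min l1 l2 < max h1 h2"
    have le: "lo x \<le> hi x" for x
      by (simp add: lo_def hi_def Liminf_le_Limsup)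
    have "AE x in \<mu>\<^sub>1. l1 \<le> h1"
      using l1 h1 by eventually_elim (use le in auto)
    moreover have "AE x in \<mu>\<^sub>2. l2 \<le> h2"
      using l2 h2 by eventually_elim (use le in auto)
    ultimately have "l1 \<le> h1" "l2 \<le> h2"
      using prob by (simp_all add: prob_space.AE_const)
    with * have eq: "h1 = l1" "l2 = l1" "h2 = l1"
      by (auto simp: not_less min_def max_def split: if_splits)
    define c where "c = (THE l. ereal l = l1)"
    have lyap_meas: "lyap_exp T A \<in> borel_measurable borel"
      unfolding lyap_exp_def by (rule borel_measurable_lim_metric[OF meas])
    have lyap: "lyap_exp T A x = c" if "lo x = l1" "hi x = l1" for x
      using that lim_eq_ereal_limit unfolding lyap_exp_def c_def lo_def hi_def by blast
    \<comment> \<open>The same \<open>c\<close> serves both measures, as it depends on \<open>l1\<close> only.\<close>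
    have "(\<integral>x. lyap_exp T A x \<partial>\<mu>) = c"
      if "prob_space \<mu>" "sets \<mu> = sets borel" "AE x in \<mu>. lo x = l1" "AE x in \<mu>. hi x = l1" for \<mu>
    proof -
      have "AE x in \<mu>. lyap_exp T A x = c"
        using that(3,4) by eventually_elim (rule lyap)
      moreover have "lyap_exp T A \<in> borel_measurable \<mu>"
        using lyap_meas that(2) by (simp cong: measurable_cong_sets)
      ultimately have "(\<integral>x. lyap_exp T A x \<partial>\<mu>) = (\<integral>x. c \<partial>\<mu>)"
        by (intro integral_cong_AE) auto
      then show ?thesis
        using that(1) by (simp add: prob_space.prob_space)
    qed
    with prob sets l1 h1 l2 h2 assms(8) show False
      by (simp add: eq)
  qed
  then have "residual (LI T A)"
    unfolding LI_def
    using residual_divergence[OF comp cont _ lo_dense[unfolded lo_def] hi_dense[unfolded hi_def]] by blast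
  with assms(2) show ?thesis
    by (simp add: R_set_def)
qed

end
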